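(* Let $n\geq 0$ be an integer. Then \[ CP_{(2,1)}(n) = \frac{1}{(q;q)_{2n}} \sum_{r=-\infty}^\infty (-1)^r q^{r(5r+1)/2} {2n \brack n-\frac{5r}{2} + \frac{(-1)^r-1}{4}}_q, \] \[ CP_{(3,0)}(n) = \frac{1}{(q;q)_{2n}} \sum_{r=-\infty}^\infty (-1)^r q^{r(5r+3)/2} {2n \brack n-\frac{5r}{2} + 3\frac{(-1)^r-1}{4}}_q. \]
   Context: $(a;q)_m=\prod_{j=0}^{m-1}(1-aq^j)$. For integers $a,b$, the $q$-binomial coefficient is ${a\brack b}_q=\frac{(q;q)_a}{(q;q)_b(q;q)_{a-b}}$ if $0\le b\le a$ and $0$ otherwise. A cylindric partition with profile $(c_1,c_2)$ (nonnegative integers) is a pair of integer partitions $(\lambda^{(1)},\lambda^{(2)})$ (parts written in weakly decreasing order $\lambda^{(i)}_1\ge\lambda^{(i)}_2\ge\cdots$, with $\lambda^{(i)}_j=0$ beyond the number of parts) such that $\lambda^{(1)}_j\ge\lambda^{(2)}_{j+c_2}$ and $\lambda^{(2)}_j\ge\lambda^{(1)}_{j+c_1}$ for all $j\ge1$. Its size is $|\lambda^{(1)}|+|\lambda^{(2)}|$. For integers $a\ge b\ge0$ and $n\ge0$, $CP_{(a,b)}(n)$ denotes the generating function $\sum q^{\text{size}}$ over cylindric partitions with profile $(a,b)$ in which each of the two partitions has at most $n$ parts; $CP_{(a,b)}(0)=1$. *)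

theory Defs
  imports
    "HOL-Computational_Algebra.Formal_Power_Series"
    "HOL-Analysis.Infinite_Sum"
begin

definition qpoch :: "'a::comm_ring_1 \<Rightarrow> 'a \<Rightarrow> nat \<Rightarrow> 'a" where
  "qpoch a q m = (\<Prod>j<m. 1 - a * q ^ j)"

text \<open>Here \<open>q\<close> is the formal variable. All divisors have constant coefficient 1, so that \<open>/\<close>
  is multiplication by the inverse power series.\<close>

definition qbinom :: "int \<Rightarrow> int \<Rightarrow> rat fps" where
  "qbinom a b =
     (if 0 \<le> b \<and> b \<le> a
      then qpoch fps_X fps_X (nat a) /
             (qpoch fps_X fps_X (nat b) * qpoch fps_X fps_X (nat (a - b)))
      else 0)"

lemma qpoch_nth_0: "fps_nth (qpoch fps_X fps_X m :: rat fps) 0 = 1"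
  by (induction m) (simp_all add: qpoch_def)

text \<open>An integer partition is the weakly decreasing list of its (positive) parts.\<close>

definition int_partition :: "nat list \<Rightarrow> bool" where
  "int_partition xs \<longleftrightarrow> sorted_wrt (\<ge>) xs \<and> (\<forall>x\<in>set xs. 0 < x)"

text \<open>Parts are numbered from 1.\<close>

definition part :: "nat list \<Rightarrow> nat \<Rightarrow> nat" where
  "part xs j = (if 1 \<le> j \<and> j \<le> length xs then xs ! (j - 1) else 0)"

definition cylindric_partition :: "nat \<times> nat \<Rightarrow> nat list \<times> nat list \<Rightarrow> bool" where
  "cylindric_partition = (\<lambda>(c1, c2) (xs, ys).
     int_partition xs \<and> int_partition ys \<and>
     (\<forall>j\<ge>1. part xs j \<ge> part ys (j + c2)) \<and>
     (\<forall>j\<ge>1. part ys j \<ge> part xs (j + c1)))"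

definition cp_size :: "nat list \<times> nat list \<Rightarrow> nat" where
  "cp_size = (\<lambda>(xs, ys). sum_list xs + sum_list ys)"

definition cp_set :: "nat \<times> nat \<Rightarrow> nat \<Rightarrow> nat \<Rightarrow> (nat list \<times> nat list) set" where
  "cp_set c n k = {(xs, ys). cylindric_partition c (xs, ys) \<and>
     length xs \<le> n \<and> length ys \<le> n \<and> cp_size (xs, ys) = k}"

definition CP :: "nat \<times> nat \<Rightarrow> nat \<Rightarrow> rat fps" where
  "CP c n = Abs_fps (\<lambda>k. of_nat (card (cp_set c n k)))"

lemma finite_cp_set: "finite (cp_set c n k)"
proof -
  let ?L = "{xs. set xs \<subseteq> {..k} \<and> length xs \<le> n}"
  have "cp_set c n k \<subseteq> ?L \<times> ?L"
    by (auto simp: cp_set_def cp_size_def dest!: member_le_sum_list)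
  moreover have "finite (?L \<times> ?L)"
    by (intro finite_cartesian_product finite_lists_length_le) auto
  ultimately show ?thesis
    by (rule finite_subset)
qed

lemma CP_0: "CP c 0 = 1"
proof -
  have "cp_set c 0 k = (if k = 0 then {([], [])} else {})" for k
    by (cases c)
      (auto simp: cp_set_def cp_size_def cylindric_partition_def int_partition_def part_def)
  then show ?thesis
    by (auto simp: CP_def fps_eq_iff)
qed

text \<open>The lower indices \<open>n - 5r/2 + c ((-1)^r - 1)/4\<close> (with \<open>c = 1\<close> or \<open>c = 3\<close>) of the
  \<open>q\<close>-binomial coefficients in the theorem are integers; the floor function merely converts
  them from \<open>rat\<close> to \<open>int\<close>.\<close>

lemma lower_index_in_Ints:
  fixes c r :: int
  assumes "odd c"
  shows "(of_nat n - 5 * of_int r / 2 + of_int c * (((-1) powi r - 1) / 4) :: rat) \<in> \<int>"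
proof (cases "even r")
  case True
  then obtain s where "r = 2 * s" by (elim evenE)
  then show ?thesis
    by (simp add: power_int_minus_left)
next
  case False
  then obtain s where s: "r = 2 * s + 1" by (elim oddE)
  obtain d where d: "c = 2 * d + 1" using assms by (elim oddE)
  have "(-1 :: rat) powi r = -1" using False by (simp add: power_int_minus_left)
  then have "(of_nat n - 5 * of_int r / 2 + of_int c * (((-1) powi r - 1) / 4) :: rat) =
      of_int (int n - 5 * s - 3 - d)"
    by (simp add: s d field_simps)
  then show ?thesis by (metis Ints_of_int)
qed

text \<open>Likewise, the exponents \<open>r (5 r + c) / 2\<close> of \<open>q\<close> are nonnegative integers.\<close>

lemma q_exponent_exact:
  fixes c r :: int
  assumes "odd c" "\<bar>c\<bar> \<le> 5"
  shows "2 * int (nat (r * (5 * r + c) div 2)) = r * (5 * r + c)"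
proof -
  have "even (r * (5 * r + c))" using assms by auto
  moreover have "0 \<le> r * (5 * r + c)"
  proof -
    consider "r = 0" | "r \<ge> 1" | "r \<le> -1" by linarith
    then show ?thesis
      using assms(2) by cases (auto intro!: mult_nonneg_nonneg mult_nonpos_nonpos)
  qed
  ultimately show ?thesis by simp
qed

text \<open>The bilateral sums in the theorem are infinite sums with respect to the \<open>X\<close>-adic
  topology on formal power series. Only finitely many terms are nonzero, so the sums exist.\<close>

lemma summable_qbinom:
  fixes c :: int and f :: "int \<Rightarrow> rat fps"
  assumes "odd c"
  shows "(\<lambda>r::int. f r * qbinom (2 * int n)
    \<lfloor>of_nat n - 5 * of_int r / 2 + of_int c * (((-1) powi r - 1) / 4) :: rat\<rfloor>) summable_on UNIV"
proof -
  let ?i = "\<lambda>r::int. of_nat n - 5 * of_int r / 2 + of_int c * (((-1) powi r - 1) / 4) :: rat"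
  let ?N = "2 * int n + \<bar>c\<bar> + 1"
  have "qbinom (2 * int n) \<lfloor>?i r\<rfloor> = 0" if r: "r \<notin> {- ?N..?N}" for r
  proof -
    obtain m where m: "?i r = of_int m"
      using lower_index_in_Ints[OF assms, of n r] by (rule Ints_cases)
    have "of_int (4 * m) = 4 * ?i r"
      unfolding m by simp
    also have "\<dots> = of_int (4 * int n - 10 * r + c * (if even r then 0 else -2))"
      by (cases "even r") (simp_all add: power_int_minus_left)
    finally have "4 * m = 4 * int n - 10 * r + c * (if even r then 0 else -2)"
      by (simp only: of_int_eq_iff)
    with r have "\<not> (0 \<le> m \<and> m \<le> 2 * int n)"
      by (auto split: if_splits)
    moreover have "\<lfloor>?i r\<rfloor> = m"
      unfolding m by (rule floor_of_int)
    ultimately show ?thesis by (simp only: qbinom_def if_False)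
  qed
  then have "(\<lambda>r. f r * qbinom (2 * int n) \<lfloor>?i r\<rfloor>) summable_on UNIV \<longleftrightarrow>
      (\<lambda>r. f r * qbinom (2 * int n) \<lfloor>?i r\<rfloor>) summable_on {- ?N..?N}"
    by (intro summable_on_cong_neutral) (simp_all only: mult_zero_right Diff_iff UNIV_I not_True_eq_False simp_thms)
  moreover have "(\<lambda>r. f r * qbinom (2 * int n) \<lfloor>?i r\<rfloor>) summable_on {- ?N..?N}"
    by (rule summable_on_finite) (rule finite_atLeastAtMost_int)
  ultimately show ?thesis by (rule iffD2)
qed

end

theory Submission
  imports Defs
begin

text \<open>Let \<open>G(a, b)\<close> be the generating function of the cylindric partitions of profile
  \<open>(c, d)\<close> whose two components have at most \<open>a\<close> and \<open>b\<close> parts. Removing the first column from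
  both components and inclusion-exclusion give
  \<open>G(a, b) - G(a-1, b) - G(a, b-1) + G(a-1, b-1) = q^(a+b) G(a, b)\<close> in the strip
  \<open>-d \<le> a - b \<le> c\<close>, while \<open>G(a, b) = G(a-1, b)\<close> for \<open>a - b = c + 1\<close> and
  \<open>G(a, b) = G(a, b-1)\<close> for \<open>b - a = d + 1\<close>, since the interlacing conditions forbid \<open>(a, b)\<close> as
  pair of lengths there. These relations determine \<open>G\<close> near the strip. The product
  \<open>1/((q)_a (q)_b)\<close> solves the recurrence, and so do its translates along \<open>a + b\<close> constant;
  the reflection principle for the two boundary lines yields the alternating sum of translates
  that satisfies both boundary conditions. It has the weights \<open>q^(2Lt^2 + (c-d)t)\<close> and
  \<open>q^(2Lt^2 + (c-d)t + 2Lt + c + 1)\<close> with \<open>L = c + d + 2\<close>; the theorem is the case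
  \<open>L = 5\<close>, \<open>a = b = n\<close>, with \<open>r = 2t\<close> and \<open>r = 2t + 1\<close>.\<close>

section \<open>Reciprocals of the \<open>q\<close>-factorials\<close>

text \<open>The value 0 at negative indices makes \<open>inv_qpoch_rec\<close> valid for all
  integers: at m = 0 the factor 1 - q^m vanishes.\<close>

definition inv_qpoch :: "int \<Rightarrow> rat fps" where
  "inv_qpoch m = (if m < 0 then 0 else inverse (qpoch fps_X fps_X (nat m)))"

lemma inv_qpoch_neg [simp]: "m < 0 \<Longrightarrow> inv_qpoch m = 0"
  by (simp add: inv_qpoch_def)

lemma inv_qpoch_0 [simp]: "inv_qpoch 0 = 1"
  by (simp add: inv_qpoch_def qpoch_def)

lemma inv_qpoch_rec: "inv_qpoch (m - 1) = inv_qpoch m - fps_X ^ nat m * inv_qpoch m"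
proof -
  consider "m < 0" | "m = 0" | "m > 0" by linarith
  then show ?thesis
  proof cases
    case 3
    define k where "k = nat (m - 1)"
    have m: "m = 1 + int k" using 3 by (simp add: k_def)
    let ?u = "1 - fps_X ^ Suc k :: rat fps" and ?p = "qpoch fps_X fps_X k :: rat fps"
    have "inverse (?p * ?u) * ?u = inverse ?p * (inverse ?u * ?u)"
      by (simp only: fps_inverse_mult ac_simps)
    also have "inverse ?u * ?u = 1"
      by (rule inverse_mult_eq_1) simp
    finally have "inverse (?p * ?u) * ?u = inverse ?p" by simp
    moreover have "?p * ?u = qpoch fps_X fps_X (Suc k)"
      by (simp add: qpoch_def)
    ultimately have "inverse (qpoch fps_X fps_X (Suc k)) * ?u = inverse ?p" by simp
    moreover have "nat m = Suc k" by (simp add: m)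
    ultimately show ?thesis
      using 3 by (simp add: inv_qpoch_def k_def [symmetric] right_diff_distrib mult.commute)
  qed simp_all
qed

definition inv_qpoch2 :: "int \<Rightarrow> int \<Rightarrow> rat fps" where
  "inv_qpoch2 a b = inv_qpoch a * inv_qpoch b"

lemma inv_qpoch2_neg [simp]:
  "a < 0 \<Longrightarrow> inv_qpoch2 a b = 0" "b < 0 \<Longrightarrow> inv_qpoch2 a b = 0"
  by (simp_all add: inv_qpoch2_def)

lemma inv_qpoch2_commute: "inv_qpoch2 a b = inv_qpoch2 b a"
  by (simp add: inv_qpoch2_def mult.commute)

lemma inv_qpoch2_diff1:
  "inv_qpoch2 a b - inv_qpoch2 (a - 1) b = fps_X ^ nat a * inv_qpoch2 a b"
  by (simp add: inv_qpoch2_def inv_qpoch_rec algebra_simps)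

lemma inv_qpoch2_diff2:
  "inv_qpoch2 a b - inv_qpoch2 a (b - 1) = fps_X ^ nat b * inv_qpoch2 a b"
  using inv_qpoch2_diff1 [of b a] by (simp only: inv_qpoch2_commute)

text \<open>The left side is a product of two one-variable differences of \<open>inv_qpoch\<close>,
  contributing q^a and q^b.\<close>

lemma inv_qpoch2_corner:
  "inv_qpoch2 a b - inv_qpoch2 (a - 1) b - inv_qpoch2 a (b - 1) + inv_qpoch2 (a - 1) (b - 1)
     = fps_X ^ nat (a + b) * inv_qpoch2 a b"
proof -
  have "inv_qpoch2 a b - inv_qpoch2 (a - 1) b - inv_qpoch2 a (b - 1) + inv_qpoch2 (a - 1) (b - 1)
     = fps_X ^ (nat a + nat b) * inv_qpoch2 a b"
    by (simp add: inv_qpoch2_def inv_qpoch_rec algebra_simps power_add)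
  also have "\<dots> = fps_X ^ nat (a + b) * inv_qpoch2 a b"
    \<comment> \<open>For a negative index \<open>nat\<close> need not be additive, but then the
      product is 0.\<close>
    by (cases "a < 0 \<or> b < 0") (auto simp: nat_add_distrib)
  finally show ?thesis .
qed

text \<open>Turns the summands of the theorem into translates of the product solution: (q;q)_{2n}
  cancels, and for |j| > n both sides are 0.\<close>

lemma qbinom_div_qpoch:
  "1 / qpoch fps_X fps_X (2 * n) * qbinom (2 * int n) (int n - j) =
     inv_qpoch2 (int n - j) (int n + j)"
proof (cases "0 \<le> int n - j \<and> 0 \<le> int n + j")
  case True
  let ?p = "\<lambda>k. qpoch fps_X fps_X k :: rat fps"
  have unit: "inverse (?p k) * ?p k = 1" for k
    by (rule inverse_mult_eq_1) (simp add: qpoch_nth_0)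
  have div: "f / g = f * inverse g" if "fps_nth g 0 = 1" for f g :: "rat fps"
    using that by (simp add: fps_divide_unit)
  have "qbinom (2 * int n) (int n - j) =
      ?p (2 * n) * inverse (?p (nat (int n - j)) * ?p (nat (int n + j)))"
    using True by (simp add: qbinom_def div qpoch_nth_0 nat_mult_distrib algebra_simps)
  then have "1 / ?p (2 * n) * qbinom (2 * int n) (int n - j) =
      (inverse (?p (2 * n)) * ?p (2 * n)) * inverse (?p (nat (int n - j)) * ?p (nat (int n + j)))"
    by (simp add: div qpoch_nth_0 mult.assoc)
  with True show ?thesis
    by (simp only: unit) (simp add: inv_qpoch2_def inv_qpoch_def fps_inverse_mult)
qed (auto simp: qbinom_def)

section \<open>The reflection sum\<close>

text \<open>Cancellation on the boundary lines forces this quadratic. With L = c + d + 2, the line a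
  - b = c + 1 requires the second exponent of index t to exceed the first by 2Lt + c + 1; the line b
  - a = d + 1 requires the first exponent of index t + 1 to exceed that second one by 2Lt + 2c + d +
  3. The start is 0 at t = 0.\<close>

definition refl_exponent :: "int \<Rightarrow> int \<Rightarrow> int \<Rightarrow> int" where
  "refl_exponent c d t = 2 * (c + d + 2) * t\<^sup>2 + (c - d) * t"

definition refl_term1 :: "int \<Rightarrow> int \<Rightarrow> int \<Rightarrow> int \<Rightarrow> int \<Rightarrow> rat fps" where
  "refl_term1 c d a b t =
     fps_X ^ nat (refl_exponent c d t) * inv_qpoch2 (a + (c + d + 2) * t) (b - (c + d + 2) * t)"

text \<open>Reflection in a - b = c + 1 sends (a, b) to (b + c + 1, a - c - 1). As
  \<open>inv_qpoch2\<close> is symmetric, reflected terms are again translates along a + b constant,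
  now by Lt + c + 1.\<close>

definition refl_term2 :: "int \<Rightarrow> int \<Rightarrow> int \<Rightarrow> int \<Rightarrow> int \<Rightarrow> rat fps" where
  "refl_term2 c d a b t =
     fps_X ^ nat (refl_exponent c d t + 2 * (c + d + 2) * t + c + 1) *
     inv_qpoch2 (a - ((c + d + 2) * t + c + 1)) (b + ((c + d + 2) * t + c + 1))"

text \<open>The cut-off keeps the sum finite; for c, d >= 0 and N at least |a| and |b|, all omitted
  terms are 0.\<close>

definition refl_sum :: "int \<Rightarrow> int \<Rightarrow> int \<Rightarrow> int \<Rightarrow> int \<Rightarrow> rat fps" where
  "refl_sum c d N a b = (\<Sum>t\<in>{-N..N}. refl_term1 c d a b t - refl_term2 c d a b t)"

text \<open>Exponents pass through \<open>nat\<close>, so adding them requires nonnegativity. It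
  holds because t (2t + 1) and t (2t - 1) are nonnegative at every integer t.\<close>

lemma refl_exponent_nonneg:
  assumes "c \<ge> 0" "d \<ge> 0"
  shows "refl_exponent c d t \<ge> 0"
proof -
  have "refl_exponent c d t = c * (t * (2 * t + 1)) + d * (t * (2 * t - 1)) + 4 * t\<^sup>2"
    by (simp add: refl_exponent_def power2_eq_square algebra_simps)
  moreover have "t * (2 * t + 1) \<ge> 0" "t * (2 * t - 1) \<ge> 0"
    by (cases "t \<ge> 0"; cases "t = 0"; simp add: zero_le_mult_iff)+
  ultimately show ?thesis using assms by simp
qed

lemma refl_exponent2_nonneg:
  assumes "c \<ge> 0" "d \<ge> 0"
  shows "refl_exponent c d t + 2 * (c + d + 2) * t + c + 1 \<ge> 0"
proof -
  have "refl_exponent c d t + 2 * (c + d + 2) * t + c + 1 =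
      c * ((t + 1) * (2 * t + 1)) + d * (t * (2 * t + 1)) + (2 * t + 1)\<^sup>2"
    by (simp add: refl_exponent_def power2_eq_square algebra_simps)
  moreover have "(t + 1) * (2 * t + 1) \<ge> 0" "t * (2 * t + 1) \<ge> 0"
    by (cases "t \<ge> 0"; cases "t = -1"; simp add: zero_le_mult_iff)+
  ultimately show ?thesis using assms by simp
qed

text \<open>Translation along a + b constant preserves the factor q^(a+b), so every term inherits
  the linear recurrence of \<open>inv_qpoch2\<close>.\<close>

lemma refl_sum_corner:
  "refl_sum c d N a b - refl_sum c d N (a - 1) b - refl_sum c d N a (b - 1)
     + refl_sum c d N (a - 1) (b - 1) = fps_X ^ nat (a + b) * refl_sum c d N a b"
proof -
  have corner: "u * inv_qpoch2 (a + j) (b - j) - u * inv_qpoch2 (a - 1 + j) (b - j)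
      - u * inv_qpoch2 (a + j) (b - 1 - j) + u * inv_qpoch2 (a - 1 + j) (b - 1 - j)
      = fps_X ^ nat (a + b) * (u * inv_qpoch2 (a + j) (b - j))" for u j
    using arg_cong [OF inv_qpoch2_corner [of "a + j" "b - j"], of "(*) u"]
    by (simp add: algebra_simps)
  have corner': "u * inv_qpoch2 (a - j) (b + j) - u * inv_qpoch2 (a - 1 - j) (b + j)
      - u * inv_qpoch2 (a - j) (b - 1 + j) + u * inv_qpoch2 (a - 1 - j) (b - 1 + j)
      = fps_X ^ nat (a + b) * (u * inv_qpoch2 (a - j) (b + j))" for u j
    using corner [of u "- j"] by simp
  have 1: "refl_term1 c d a b t - refl_term1 c d (a - 1) b t - refl_term1 c d a (b - 1) t
      + refl_term1 c d (a - 1) (b - 1) t = fps_X ^ nat (a + b) * refl_term1 c d a b t" for t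
    unfolding refl_term1_def by (rule corner)
  have 2: "refl_term2 c d a b t - refl_term2 c d (a - 1) b t - refl_term2 c d a (b - 1) t
      + refl_term2 c d (a - 1) (b - 1) t = fps_X ^ nat (a + b) * refl_term2 c d a b t" for t
    unfolding refl_term2_def by (rule corner')
  show ?thesis
    unfolding refl_sum_def sum_distrib_left sum_subtractf [symmetric] sum.distrib [symmetric]
    by (rule sum.cong [OF refl]) (simp add: right_diff_distrib 1 [symmetric] 2 [symmetric])
qed

lemma fps_X_power_nat_mult:
  assumes "m + k = m' + k'" "m \<ge> 0" "m' \<ge> 0" "k \<ge> 0" "k' \<ge> 0"
  shows "fps_X ^ nat m * (fps_X ^ nat k * f) = fps_X ^ nat m' * (fps_X ^ nat k' * f)"
  using assms by (simp add: mult.assoc [symmetric] power_add [symmetric] nat_add_distrib [symmetric])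

text \<open>On the line \<open>a - b = c + 1\<close> the two terms with the same index cancel; on the line
  \<open>b - a = d + 1\<close> the second term with index \<open>t\<close> cancels the first one with index \<open>t + 1\<close>.\<close>

lemma refl_sum_boundary1:
  assumes "c \<ge> 0" "d \<ge> 0" "a = b + c + 1"
  shows "refl_sum c d N a b = refl_sum c d N (a - 1) b"
proof -
  have "refl_term1 c d a b t - refl_term1 c d (a - 1) b t =
        refl_term2 c d a b t - refl_term2 c d (a - 1) b t" for t
  proof -
    define j where "j = (c + d + 2) * t"
    let ?e = "refl_exponent c d t"
    have "refl_term1 c d a b t - refl_term1 c d (a - 1) b t =
        fps_X ^ nat ?e * (inv_qpoch2 (a + j) (b - j) - inv_qpoch2 (a + j - 1) (b - j))"
      by (simp add: refl_term1_def j_def algebra_simps)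
    also have "\<dots> = fps_X ^ nat ?e * (fps_X ^ nat (a + j) * inv_qpoch2 (a + j) (b - j))"
      by (simp only: inv_qpoch2_diff1)
    \<comment> \<open>The exponents balance because a = b + c + 1 gives a + j = (2j + c + 1) + (b -
      j); moreover (b - j, a + j) is the argument pair of the second term.\<close>
    also have "\<dots> = fps_X ^ nat (?e + 2 * j + c + 1) *
        (fps_X ^ nat (b - j) * inv_qpoch2 (b - j) (a + j))"
    proof (cases "a + j \<ge> 0 \<and> b - j \<ge> 0")
      case True
      then show ?thesis
        using assms refl_exponent_nonneg [of c d t] refl_exponent2_nonneg [of c d t]
        by (subst inv_qpoch2_commute, intro fps_X_power_nat_mult)
          (auto simp: j_def mult.assoc [symmetric])
    qed auto
    also have "\<dots> = fps_X ^ nat (?e + 2 * j + c + 1) *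
        (inv_qpoch2 (b - j) (a + j) - inv_qpoch2 (b - j - 1) (a + j))"
      by (simp only: inv_qpoch2_diff1)
    also have "\<dots> = refl_term2 c d a b t - refl_term2 c d (a - 1) b t"
      by (simp add: refl_term2_def j_def assms algebra_simps)
    finally show ?thesis .
  qed
  then have "refl_term1 c d a b t - refl_term2 c d a b t =
      refl_term1 c d (a - 1) b t - refl_term2 c d (a - 1) b t" for t
    by (simp add: algebra_simps)
  then show ?thesis by (simp add: refl_sum_def)
qed

lemma refl_sum_boundary2:
  assumes "c \<ge> 0" "d \<ge> 0" "b = a + d + 1" "\<bar>a\<bar> < N" "\<bar>b\<bar> < N"
  shows "refl_sum c d N a b = refl_sum c d N a (b - 1)"
proof -
  define f where "f t = refl_term1 c d a b t - refl_term1 c d a (b - 1) t" for t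
  define g where "g t = refl_term2 c d a b t - refl_term2 c d a (b - 1) t" for t
  have shift: "f (t + 1) = g t" for t
  proof -
    \<comment> \<open>With this shift, b = a + d + 1 makes (b + j, a - j) the arguments of the first
      term of index t + 1: the swap of those of the second term of index t.\<close>
    define j where "j = (c + d + 2) * t + c + 1"
    let ?e = "refl_exponent c d t" and ?e' = "refl_exponent c d (t + 1)"
    have e': "?e' + (a - j) = ?e + 2 * (c + d + 2) * t + c + 1 + (b + j)"
      by (simp add: refl_exponent_def j_def assms power2_eq_square algebra_simps)
    have "g t = fps_X ^ nat (?e + 2 * (c + d + 2) * t + c + 1) *
        (inv_qpoch2 (a - j) (b + j) - inv_qpoch2 (a - j) (b + j - 1))"
      by (simp add: g_def refl_term2_def j_def algebra_simps)
    also have "\<dots> = fps_X ^ nat (?e + 2 * (c + d + 2) * t + c + 1) *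
        (fps_X ^ nat (b + j) * inv_qpoch2 (a - j) (b + j))"
      by (simp only: inv_qpoch2_diff2)
    also have "\<dots> = fps_X ^ nat ?e' * (fps_X ^ nat (a - j) * inv_qpoch2 (b + j) (a - j))"
    proof (cases "a - j \<ge> 0 \<and> b + j \<ge> 0")
      case True
      then show ?thesis
        using assms e' refl_exponent_nonneg [of c d "t + 1"] refl_exponent2_nonneg [of c d t]
        by (subst inv_qpoch2_commute, intro fps_X_power_nat_mult) auto
    qed auto
    also have "\<dots> = fps_X ^ nat ?e' *
        (inv_qpoch2 (b + j) (a - j) - inv_qpoch2 (b + j) (a - j - 1))"
      by (simp only: inv_qpoch2_diff2)
    also have "\<dots> = f (t + 1)"
      by (simp add: f_def refl_term1_def j_def assms algebra_simps)
    finally show ?thesis ..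
  qed
  \<comment> \<open>Pairing f (t + 1) with g t over a finite window leaves f (-N) and g N over;
    there the first argument is negative, since a < N <= L N.\<close>
  have N: "N > 0" using assms by linarith
  have L: "N \<le> (c + d + 2) * N"
    using N assms mult_right_mono [of 1 "c + d + 2" N] by simp
  have "f (-N) = 0"
    using assms L by (simp add: f_def refl_term1_def)
  have "g N = 0"
    using assms L by (simp add: g_def refl_term2_def)
  have "sum f {-N..N} = sum f {-N+1..N}"
  proof (rule sum.mono_neutral_right)
    show "\<forall>t\<in>{-N..N} - {-N+1..N}. f t = 0"
    proof
      fix t assume "t \<in> {-N..N} - {-N+1..N}"
      then have "t = -N" by auto
      with \<open>f (-N) = 0\<close> show "f t = 0" by simp
    qed
  qed auto
  also have "\<dots> = (\<Sum>t\<in>{-N..N-1}. f (t + 1))"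
    by (rule sum.reindex_bij_witness [of _ "\<lambda>t. t + 1" "\<lambda>t. t - 1"]) auto
  also have "\<dots> = sum g {-N..N-1}"
    by (simp only: shift)
  also have "\<dots> = sum g {-N..N}"
  proof (rule sum.mono_neutral_left)
    show "\<forall>t\<in>{-N..N} - {-N..N-1}. g t = 0"
    proof
      fix t assume "t \<in> {-N..N} - {-N..N-1}"
      then have "t = N" by auto
      with \<open>g N = 0\<close> show "g t = 0" by simp
    qed
  qed auto
  finally have "sum f {-N..N} = sum g {-N..N}" .
  then show ?thesis
    by (simp add: refl_sum_def f_def g_def sum_subtractf algebra_simps)
qed

text \<open>In the widened strip a negative coordinate forces a <= c and b <= d. Every nonzero shift
  lowers a by at least c + 1 or b by at least d + 1, and the unshifted term is 0 already.\<close>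

lemma refl_sum_neg:
  assumes "c \<ge> 0" "d \<ge> 0" "a < 0 \<or> b < 0" "a - b \<le> c + 1" "b - a \<le> d + 1"
  shows "refl_sum c d N a b = 0"
proof -
  have "refl_term1 c d a b t = 0 \<and> refl_term2 c d a b t = 0" for t
  proof -
    define j where "j = (c + d + 2) * t"
    have *: "j \<le> - (c + d + 2) \<or> j = 0 \<or> j \<ge> c + d + 2"
    proof -
      consider "t \<le> -1" | "t = 0" | "t \<ge> 1" by linarith
      then show ?thesis
        using assms(1,2) mult_left_mono [of t "-1" "c + d + 2"] mult_left_mono [of 1 t "c + d + 2"]
        by cases (auto simp: j_def)
    qed
    have "a + j < 0 \<or> b - j < 0"
      using * assms by linarith
    moreover have "a - (j + c + 1) < 0 \<or> b + (j + c + 1) < 0"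
      using * assms by linarith
    ultimately show ?thesis
      by (auto simp: refl_term1_def refl_term2_def j_def)
  qed
  then show ?thesis by (simp add: refl_sum_def)
qed

text \<open>The two arguments add up to 0, so a term survives only with shift 0. The shifts Lt + c +
  1 of the second terms are never 0, as 0 < c + 1 < L.\<close>

lemma refl_sum_origin:
  assumes "c \<ge> 0" "d \<ge> 0" "N \<ge> 0"
  shows "refl_sum c d N 0 0 = 1"
proof -
  have "refl_term1 c d 0 0 t - refl_term2 c d 0 0 t = (if t = 0 then 1 else 0)" for t
  proof -
    define j where "j = (c + d + 2) * t"
    have *: "t \<le> -1 \<and> j \<le> - (c + d + 2) \<or> t = 0 \<and> j = 0 \<or> t \<ge> 1 \<and> j \<ge> c + d + 2"
    proof -
      consider "t \<le> -1" | "t = 0" | "t \<ge> 1" by linarith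
      then show ?thesis
        using assms(1,2) mult_left_mono [of t "-1" "c + d + 2"] mult_left_mono [of 1 t "c + d + 2"]
        by cases (auto simp: j_def)
    qed
    have "- (j + c + 1) < 0 \<or> j + c + 1 < 0"
      using * assms by linarith
    then have "inv_qpoch2 (0 - (j + c + 1)) (0 + (j + c + 1)) = 0"
      by auto
    then have "refl_term2 c d 0 0 t = 0"
      by (simp add: refl_term2_def j_def)
    moreover have "refl_term1 c d 0 0 t = (if t = 0 then 1 else 0)"
      using * assms
      by (auto simp: refl_term1_def j_def [symmetric])
        (simp_all add: refl_exponent_def inv_qpoch2_def)
    ultimately show ?thesis by simp
  qed
  then show ?thesis using assms by (simp add: refl_sum_def)
qed

section \<open>Cylindric partitions with bounded numbers of parts\<close>

text \<open>Integer bounds let the recurrence reach -1, where the box is empty.\<close>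

definition cp_box :: "nat \<times> nat \<Rightarrow> int \<Rightarrow> int \<Rightarrow> nat \<Rightarrow> (nat list \<times> nat list) set" where
  "cp_box c a b k = {(xs, ys). cylindric_partition c (xs, ys) \<and>
     int (length xs) \<le> a \<and> int (length ys) \<le> b \<and> cp_size (xs, ys) = k}"

definition cp_exact :: "nat \<times> nat \<Rightarrow> nat \<Rightarrow> nat \<Rightarrow> nat \<Rightarrow> (nat list \<times> nat list) set" where
  "cp_exact c a b k = {(xs, ys). cylindric_partition c (xs, ys) \<and>
     length xs = a \<and> length ys = b \<and> cp_size (xs, ys) = k}"

definition cp_box_gf :: "nat \<times> nat \<Rightarrow> int \<Rightarrow> int \<Rightarrow> rat fps" where
  "cp_box_gf c a b = Abs_fps (\<lambda>k. of_nat (card (cp_box c a b k)))"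

lemma CP_eq_cp_box_gf: "CP c n = cp_box_gf c (int n) (int n)"
  by (simp add: CP_def cp_box_gf_def cp_set_def cp_box_def)

lemma finite_cp_box: "finite (cp_box c a b k)"
  by (rule finite_subset [OF _ finite_cp_set [of c "nat (max a b)" k]])
    (auto simp: cp_box_def cp_set_def)

lemma cp_box_neg: "a < 0 \<or> b < 0 \<Longrightarrow> cp_box c a b k = {}"
  by (auto simp: cp_box_def)

section \<open>Adding and removing the first column\<close>

definition add_column :: "nat \<Rightarrow> nat list \<Rightarrow> nat list" where
  "add_column a xs = map Suc xs @ replicate (a - length xs) 1"

definition del_column :: "nat list \<Rightarrow> nat list" where
  "del_column xs = filter (\<lambda>x. 0 < x) (map (\<lambda>x. x - 1) xs)"

lemma length_add_column: "length xs \<le> a \<Longrightarrow> length (add_column a xs) = a"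
  by (simp add: add_column_def)

lemma sum_list_add_column: "length xs \<le> a \<Longrightarrow> sum_list (add_column a xs) = sum_list xs + a"
proof -
  have "sum_list (map Suc xs) = sum_list xs + length xs" by (induction xs) auto
  then show "length xs \<le> a \<Longrightarrow> ?thesis" by (simp add: add_column_def sum_list_replicate)
qed

lemma int_partition_add_column:
  assumes "int_partition xs"
  shows "int_partition (add_column a xs)"
proof -
  have "sorted_wrt (\<ge>) (replicate m (1 :: nat))" for m
    by (induction m) auto
  with assms show ?thesis
    by (auto simp: int_partition_def add_column_def sorted_wrt_append sorted_wrt_map)
qed

lemma part_add_column:
  "length xs \<le> a \<Longrightarrow> part (add_column a xs) j = (if 1 \<le> j \<and> j \<le> a then Suc (part xs j) else 0)"
  by (auto simp: part_def add_column_def nth_append)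

lemma del_add_column: "int_partition xs \<Longrightarrow> del_column (add_column a xs) = xs"
  by (auto simp: int_partition_def del_column_def add_column_def comp_def)

lemma int_partition_del_column:
  assumes "int_partition xs"
  shows "int_partition (del_column xs)"
proof -
  have "sorted_wrt (\<lambda>x y. y - 1 \<le> x - 1) xs"
    by (rule sorted_wrt_mono_rel [of _ "(\<ge>)"]) (use assms in \<open>auto simp: int_partition_def\<close>)
  then show ?thesis
    by (auto simp: int_partition_def del_column_def sorted_wrt_map intro!: sorted_wrt_filter)
qed

lemma length_del_column: "length (del_column xs) \<le> length xs"
  by (simp add: del_column_def length_filter_le [THEN order_trans])

lemma add_del_column: "int_partition xs \<Longrightarrow> add_column (length xs) (del_column xs) = xs"
proof (induction xs)
  case (Cons x xs)
  then have IH: "add_column (length xs) (del_column xs) = xs"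
    by (auto simp: int_partition_def)
  show ?case
  proof (cases "x = 1")
    case True
    then have "\<forall>y\<in>set xs. y = 1"
      using Cons.prems by (auto simp: int_partition_def le_Suc_eq)
    then have "del_column (x # xs) = []" "xs = replicate (length xs) 1"
      using True by (auto simp: del_column_def filter_empty_conv intro: replicate_eqI)
    then show ?thesis using True by (simp add: add_column_def)
  next
    case False
    then have "del_column (x # xs) = (x - 1) # del_column xs" "x > 1"
      using Cons.prems by (auto simp: del_column_def int_partition_def)
    then show ?thesis using IH by (simp add: add_column_def)
  qed
qed (simp add: add_column_def del_column_def)

text \<open>Both sides of an inequality grow by 1 unless an index exceeds the column height. The
  bounds on a and b exclude that only the smaller side grows; where the smaller side does not grow,
  it is 0.\<close>

lemma cylindric_add_column:
  assumes "length xs \<le> a" "length ys \<le> b" "a \<le> b + c1" "b \<le> a + c2"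
    "int_partition xs" "int_partition ys"
  shows "cylindric_partition (c1, c2) (add_column a xs, add_column b ys) \<longleftrightarrow>
    cylindric_partition (c1, c2) (xs, ys)"
proof -
  have "part (add_column a xs) j \<ge> part (add_column b ys) (j + c2) \<longleftrightarrow>
      part xs j \<ge> part ys (j + c2)" if "j \<ge> 1" for j
    using assms that by (auto simp: part_add_column) (auto simp: part_def)
  moreover have "part (add_column b ys) j \<ge> part (add_column a xs) (j + c1) \<longleftrightarrow>
      part ys j \<ge> part xs (j + c1)" if "j \<ge> 1" for j
    using assms that by (auto simp: part_add_column) (auto simp: part_def)
  ultimately show ?thesis
    using assms by (auto simp: cylindric_partition_def int_partition_add_column)
qed

lemma card_cp_exact:
  assumes "a \<le> b + c1" "b \<le> a + c2"
  shows "card (cp_exact (c1, c2) a b k) =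
    (if a + b \<le> k then card (cp_box (c1, c2) (int a) (int b) (k - (a + b))) else 0)"
proof (cases "a + b \<le> k")
  case True
  let ?add = "\<lambda>(xs, ys). (add_column a xs, add_column b ys)"
  let ?del = "\<lambda>(xs, ys). (del_column xs, del_column ys)"
  have "bij_betw ?add (cp_box (c1, c2) (int a) (int b) (k - (a + b))) (cp_exact (c1, c2) a b k)"
  proof (rule bij_betw_byWitness [where f' = ?del])
    show "\<forall>p\<in>cp_box (c1, c2) (int a) (int b) (k - (a + b)). ?del (?add p) = p"
      by (auto simp: cp_box_def cylindric_partition_def del_add_column)
    show "\<forall>p\<in>cp_exact (c1, c2) a b k. ?add (?del p) = p"
      by (auto simp: cp_exact_def cylindric_partition_def add_del_column)
    show "?add ` cp_box (c1, c2) (int a) (int b) (k - (a + b)) \<subseteq> cp_exact (c1, c2) a b k"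
    proof clarify
      fix xs ys assume "(xs, ys) \<in> cp_box (c1, c2) (int a) (int b) (k - (a + b))"
      then have *: "cylindric_partition (c1, c2) (xs, ys)" "length xs \<le> a" "length ys \<le> b"
        "cp_size (xs, ys) = k - (a + b)" "int_partition xs" "int_partition ys"
        by (auto simp: cp_box_def cylindric_partition_def)
      then show "(add_column a xs, add_column b ys) \<in> cp_exact (c1, c2) a b k"
        using assms True
        by (auto simp: cp_exact_def cylindric_add_column length_add_column cp_size_def
            sum_list_add_column)
    qed
    show "?del ` cp_exact (c1, c2) a b k \<subseteq> cp_box (c1, c2) (int a) (int b) (k - (a + b))"
    proof clarify
      fix xs ys assume "(xs, ys) \<in> cp_exact (c1, c2) a b k"
      then have *: "cylindric_partition (c1, c2) (xs, ys)" "length xs = a" "length ys = b"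
        "cp_size (xs, ys) = k" "int_partition xs" "int_partition ys"
        by (auto simp: cp_exact_def cylindric_partition_def)
      let ?us = "del_column xs" and ?vs = "del_column ys"
      have l: "length ?us \<le> a" "length ?vs \<le> b"
        using * length_del_column by blast+
      have e: "add_column a ?us = xs" "add_column b ?vs = ys"
        using * add_del_column by blast+
      have "cylindric_partition (c1, c2) (?us, ?vs)"
        using cylindric_add_column [OF l assms, of] * e int_partition_del_column by simp
      moreover have "sum_list xs = sum_list ?us + a" "sum_list ys = sum_list ?vs + b"
        using sum_list_add_column l e by metis+
      ultimately show "(?us, ?vs) \<in> cp_box (c1, c2) (int a) (int b) (k - (a + b))"
        using * l by (auto simp: cp_box_def cp_size_def)
    qed
  qed
  then show ?thesis using True by (simp add: bij_betw_same_card)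
next
  case False
  \<comment> \<open>Parts are positive, so no pair with a and b parts has size below a + b.\<close>
  have ge: "sum_list xs \<ge> length xs" if "int_partition xs" for xs
    using that by (induction xs) (auto simp: int_partition_def Suc_le_eq intro: add_less_le_mono)
  have "cp_exact (c1, c2) a b k = {}"
    using False by (auto simp: cp_exact_def cp_size_def cylindric_partition_def dest!: ge)
  then show ?thesis using False by simp
qed

section \<open>Recurrence and boundary conditions of the generating functions\<close>

lemma cp_box_gf_corner:
  assumes "0 \<le> a" "0 \<le> b" "a - b \<le> int c1" "b - a \<le> int c2"
  shows "cp_box_gf (c1, c2) a b - cp_box_gf (c1, c2) (a - 1) b - cp_box_gf (c1, c2) a (b - 1)
    + cp_box_gf (c1, c2) (a - 1) (b - 1) = fps_X ^ nat (a + b) * cp_box_gf (c1, c2) a b"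
proof (rule fps_ext)
  fix k
  obtain a' b' where ab: "a = int a'" "b = int b'"
    using assms(1,2) by (metis nonneg_int_cases)
  let ?A = "\<lambda>a b. cp_box (c1, c2) a b k"
  let ?B = "cp_exact (c1, c2) (nat a) (nat b) k"
  \<comment> \<open>A pair in the box has fewer than a parts in the first component, fewer than b in
    the second, or exactly a and b; column removal counts the last class.\<close>
  have split: "?A a b = (?A (a - 1) b \<union> ?A a (b - 1)) \<union> ?B"
    and int: "?A (a - 1) (b - 1) = ?A (a - 1) b \<inter> ?A a (b - 1)"
    and disj: "(?A (a - 1) b \<union> ?A a (b - 1)) \<inter> ?B = {}"
    by (auto simp: ab cp_box_def cp_exact_def)
  have fin: "finite ?B"
    using finite_subset [OF _ finite_cp_box [of "(c1, c2)" a b k], of ?B] split by blast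
  have "card (?A a b) = card (?A (a - 1) b \<union> ?A a (b - 1)) + card ?B"
    by (subst split, rule card_Un_disjoint) (auto simp: finite_cp_box fin disj)
  moreover have "card (?A (a - 1) b) + card (?A a (b - 1)) =
      card (?A (a - 1) b \<union> ?A a (b - 1)) + card (?A (a - 1) (b - 1))"
    unfolding int by (rule card_Un_Int) (simp_all add: finite_cp_box)
  ultimately have "card (?A a b) + card (?A (a - 1) (b - 1)) =
      card (?A (a - 1) b) + card (?A a (b - 1)) + card ?B"
    by simp
  then have "(of_nat (card (?A a b)) + of_nat (card (?A (a - 1) (b - 1))) :: rat) =
      of_nat (card (?A (a - 1) b)) + of_nat (card (?A a (b - 1))) + of_nat (card ?B)"
    by (metis of_nat_add)
  moreover have "card ?B = (if nat (a + b) \<le> k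
      then card (cp_box (c1, c2) a b (k - nat (a + b))) else 0)"
    using assms by (subst card_cp_exact) (auto simp: nat_add_distrib)
  ultimately show "fps_nth (cp_box_gf (c1, c2) a b - cp_box_gf (c1, c2) (a - 1) b
      - cp_box_gf (c1, c2) a (b - 1) + cp_box_gf (c1, c2) (a - 1) (b - 1)) k =
      fps_nth (fps_X ^ nat (a + b) * cp_box_gf (c1, c2) a b) k"
    by (auto simp: cp_box_gf_def fps_X_power_mult_nth)
qed

text \<open>If the first partition had a parts, its last, positive part would be bounded by part
  number a - c1 = b + 1 of the second, which is 0.\<close>

lemma cp_box_gf_boundary1:
  assumes "a = b + int c1 + 1"
  shows "cp_box_gf (c1, c2) a b = cp_box_gf (c1, c2) (a - 1) b"
proof -
  have "int (length xs) \<noteq> a"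
    if cyl: "cylindric_partition (c1, c2) (xs, ys)" and len: "int (length ys) \<le> b" for xs ys
  proof
    assume a: "int (length xs) = a"
    define j where "j = length xs - c1"
    have j: "j \<ge> 1" "j + c1 = length xs" "length ys < j"
      using a len assms by (auto simp: j_def)
    then have "part xs (j + c1) > 0"
      using cyl by (auto simp: part_def cylindric_partition_def int_partition_def)
    moreover have "part ys j \<ge> part xs (j + c1)"
      using cyl \<open>j \<ge> 1\<close> by (auto simp: cylindric_partition_def)
    ultimately show False using j by (simp add: part_def)
  qed
  then have "cp_box (c1, c2) a b k = cp_box (c1, c2) (a - 1) b k" for k
    by (force simp: cp_box_def)
  then show ?thesis by (simp add: cp_box_gf_def)
qed

lemma cp_box_gf_boundary2:
  assumes "b = a + int c2 + 1"
  shows "cp_box_gf (c1, c2) a b = cp_box_gf (c1, c2) a (b - 1)"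
proof -
  have "int (length ys) \<noteq> b"
    if cyl: "cylindric_partition (c1, c2) (xs, ys)" and len: "int (length xs) \<le> a" for xs ys
  proof
    assume b: "int (length ys) = b"
    define j where "j = length ys - c2"
    have j: "j \<ge> 1" "j + c2 = length ys" "length xs < j"
      using b len assms by (auto simp: j_def)
    then have "part ys (j + c2) > 0"
      using cyl by (auto simp: part_def cylindric_partition_def int_partition_def)
    moreover have "part xs j \<ge> part ys (j + c2)"
      using cyl \<open>j \<ge> 1\<close> by (auto simp: cylindric_partition_def)
    ultimately show False using j by (simp add: part_def)
  qed
  then have "cp_box (c1, c2) a b k = cp_box (c1, c2) a (b - 1) k" for k
    by (force simp: cp_box_def)
  then show ?thesis by (simp add: cp_box_gf_def)
qed

text \<open>The strip is widened by one line on each side because predecessors of its points can lie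
  there; from such a line one step leads back inside.\<close>

theorem cp_box_gf_eq_refl_sum:
  assumes "a < N" "b < N" "a - b \<le> int c1 + 1" "b - a \<le> int c2 + 1"
  shows "cp_box_gf (c1, c2) a b = refl_sum (int c1) (int c2) N a b"
  using assms
proof (induction "nat a + nat b" arbitrary: a b rule: less_induct)
  case (less a b)
  let ?G = "cp_box_gf (c1, c2)" and ?H = "refl_sum (int c1) (int c2) N"
  consider "a < 0 \<or> b < 0" | "a = 0" "b = 0" | "a \<ge> 0" "b \<ge> 0" "a - b = int c1 + 1"
    | "a \<ge> 0" "b \<ge> 0" "b - a = int c2 + 1"
    | "a \<ge> 0" "b \<ge> 0" "a + b > 0" "a - b \<le> int c1" "b - a \<le> int c2"
    using less.prems by linarith
  then show ?case
  proof cases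
    case 1
    then have "?G a b = 0"
      by (simp add: cp_box_gf_def cp_box_neg fps_zero_def)
    with 1 less.prems show ?thesis by (simp add: refl_sum_neg)
  next
    case 2
    have "CP (c1, c2) 0 = 1" by (rule CP_0)
    with 2 less.prems show ?thesis by (simp add: CP_eq_cp_box_gf refl_sum_origin)
  next
    case 3
    then have "?G (a - 1) b = ?H (a - 1) b"
      using less.prems by (intro less.hyps) auto
    with 3 show ?thesis
      using cp_box_gf_boundary1 [of a b c1 c2] refl_sum_boundary1 [of "int c1" "int c2" a b N]
      by simp
  next
    case 4
    then have "?G a (b - 1) = ?H a (b - 1)"
      using less.prems by (intro less.hyps) auto
    with 4 less.prems show ?thesis
      using cp_box_gf_boundary2 [of b a c2 c1] refl_sum_boundary2 [of "int c1" "int c2" b a N]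
      by simp
  next
    case 5
    have IH1: "?G (a - 1) b = ?H (a - 1) b"
    proof (cases "a = 0")
      case True
      then show ?thesis using 5
        by (simp add: cp_box_gf_def cp_box_neg fps_zero_def refl_sum_neg)
    next
      case False
      then show ?thesis using 5 less.prems by (intro less.hyps) auto
    qed
    have IH2: "?G a (b - 1) = ?H a (b - 1)"
    proof (cases "b = 0")
      case True
      then show ?thesis using 5
        by (simp add: cp_box_gf_def cp_box_neg fps_zero_def refl_sum_neg)
    next
      case False
      then show ?thesis using 5 less.prems by (intro less.hyps) auto
    qed
    have IH3: "?G (a - 1) (b - 1) = ?H (a - 1) (b - 1)"
      using 5 less.prems by (intro less.hyps) auto
    \<comment> \<open>This factor is cancellable because a + b > 0, which is why the origin is a
      separate case.\<close>
    let ?u = "1 - fps_X ^ nat (a + b) :: rat fps"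
    have "?u * ?G a b = ?H (a - 1) b + ?H a (b - 1) - ?H (a - 1) (b - 1)"
      using cp_box_gf_corner [OF 5(1,2,4,5)] unfolding IH1 IH2 IH3 by (simp add: algebra_simps)
    also have "\<dots> = ?u * ?H a b"
      using refl_sum_corner [of "int c1" "int c2" N a b] by (simp add: algebra_simps)
    finally have "?u * ?G a b = ?u * ?H a b" .
    moreover have "fps_nth ?u 0 = 1" using 5 by simp
    then have "?u \<noteq> 0" by (metis fps_zero_nth zero_neq_one)
    ultimately show ?thesis by simp
  qed
qed

section \<open>The bilateral sums for c1 + c2 = 3\<close>

lemma sum_int_even_odd:
  fixes g :: "int \<Rightarrow> 'a::comm_monoid_add"
  shows "(\<Sum>r\<in>{-2 * N..2 * N + 1}. g r) = (\<Sum>t\<in>{-N..N}. g (2 * t) + g (2 * t + 1))"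
proof -
  let ?S = "{-N..N}"
  have "r \<in> (\<lambda>t. 2 * t) ` ?S \<union> (\<lambda>t. 2 * t + 1) ` ?S" if "r \<in> {-2 * N..2 * N + 1}" for r
  proof (cases "even r")
    case True
    then show ?thesis using that by (intro UnI1 image_eqI [of _ _ "r div 2"]) auto
  next
    case False
    then show ?thesis using that by (intro UnI2 image_eqI [of _ _ "r div 2"]) auto
  qed
  then have "{-2 * N..2 * N + 1} \<subseteq> (\<lambda>t. 2 * t) ` ?S \<union> (\<lambda>t. 2 * t + 1) ` ?S"
    by blast
  moreover have "(\<lambda>t. 2 * t) ` ?S \<union> (\<lambda>t. 2 * t + 1) ` ?S \<subseteq> {-2 * N..2 * N + 1}"
    by auto
  ultimately have "{-2 * N..2 * N + 1} = (\<lambda>t. 2 * t) ` ?S \<union> (\<lambda>t. 2 * t + 1) ` ?S"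
    by (rule equalityI)
  moreover have "(\<lambda>t. 2 * t) ` ?S \<inter> (\<lambda>t. 2 * t + 1) ` ?S = {}"
    by auto presburger
  ultimately have "sum g {-2 * N..2 * N + 1} =
      sum g ((\<lambda>t. 2 * t) ` ?S) + sum g ((\<lambda>t. 2 * t + 1) ` ?S)"
    by (simp add: sum.union_disjoint)
  then show ?thesis
    by (simp add: sum.reindex inj_on_def sum.distrib)
qed

lemma CP_level_3:
  fixes e :: int
  assumes "c1 + c2 = 3" "e = int c1 - int c2"
  shows "CP (c1, c2) n = 1 / qpoch fps_X fps_X (2 * n) *
    (\<Sum>\<^sub>\<infinity>r::int\<in>UNIV. fps_const ((-1) powi r) * fps_X ^ nat (r * (5 * r + e) div 2) *
       qbinom (2 * int n)
         \<lfloor>of_nat n - 5 * of_int r / 2 + of_int e * (((-1) powi r - 1) / 4) :: rat\<rfloor>)"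
proof -
  \<comment> \<open>Meets the strict bounds at a = b = n, and the window from -2N to 2N + 1 contains
    all nonzero summands.\<close>
  define N where "N = int n + 1"
  define g where "g r = fps_const ((-1) powi r) * fps_X ^ nat (r * (5 * r + e) div 2) *
       qbinom (2 * int n)
         \<lfloor>of_nat n - 5 * of_int r / 2 + of_int e * (((-1) powi r - 1) / 4) :: rat\<rfloor>" for r
  have c2: "int c2 = 3 - int c1" and e: "e = 2 * int c1 - 3"
    using assms by simp_all
  let ?P = "1 / qpoch fps_X fps_X (2 * n) :: rat fps"
  have even: "g (2 * t) = fps_X ^ nat (t * (10 * t + e)) * qbinom (2 * int n) (int n - 5 * t)" for t
  proof -
    have "of_nat n - 5 * of_int (2 * t) / 2 + of_int e * (((-1) powi (2 * t) - 1) / 4) =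
        (of_int (int n - 5 * t) :: rat)"
      by (simp add: power_int_minus_left)
    then have "\<lfloor>of_nat n - 5 * of_int (2 * t) / 2 + of_int e * (((-1) powi (2 * t) - 1) / 4) :: rat\<rfloor>
        = int n - 5 * t"
      by (simp only: floor_of_int)
    then show ?thesis
      by (simp add: g_def power_int_minus_left mult.assoc)
  qed
  have odd: "g (2 * t + 1) = - (fps_X ^ nat ((2 * t + 1) * (5 * t + int c1 + 1)) *
      qbinom (2 * int n) (int n - (5 * t + int c1 + 1)))" for t
  proof -
    \<comment> \<open>Since e = 2 c1 - 3, 5 (2t + 1) / 2 + e / 2 = 5t + c1 + 1, the shift of the
      second term.\<close>
    have "of_nat n - 5 * of_int (2 * t + 1) / 2 + of_int e * (((-1) powi (2 * t + 1) - 1) / 4) =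
        (of_int (int n - (5 * t + int c1 + 1)) :: rat)"
      by (simp add: power_int_minus_left e field_simps)
    then have "\<lfloor>of_nat n - 5 * of_int (2 * t + 1) / 2
          + of_int e * (((-1) powi (2 * t + 1) - 1) / 4) :: rat\<rfloor> = int n - (5 * t + int c1 + 1)"
      by (simp only: floor_of_int)
    moreover have "(2 * t + 1) * (5 * (2 * t + 1) + e) = 2 * ((2 * t + 1) * (5 * t + int c1 + 1))"
      by (simp add: e algebra_simps)
    then have "(2 * t + 1) * (5 * (2 * t + 1) + e) div 2 = (2 * t + 1) * (5 * t + int c1 + 1)"
      by linarith
    ultimately show ?thesis
      by (simp add: g_def power_int_minus_left flip: fps_const_neg)
  qed
  have zero: "g r = 0" if "r \<notin> {-2 * N..2 * N + 1}" for r
  proof (cases "even r")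
    case True
    then obtain t where r: "r = 2 * t" by (elim evenE)
    then show ?thesis using that by (auto simp: even qbinom_def N_def)
  next
    case False
    then obtain t where r: "r = 2 * t + 1" by (elim oddE)
    then show ?thesis using that assms by (auto simp: odd qbinom_def N_def)
  qed
  have t1: "?P * g (2 * t) = refl_term1 (int c1) (int c2) (int n) (int n) t" for t
  proof -
    have "?P * g (2 * t) = fps_X ^ nat (t * (10 * t + e)) *
        (?P * qbinom (2 * int n) (int n - 5 * t))"
      unfolding even by (simp only: ac_simps)
    also have "\<dots> = fps_X ^ nat (t * (10 * t + e)) * inv_qpoch2 (int n + 5 * t) (int n - 5 * t)"
      unfolding qbinom_div_qpoch by (subst inv_qpoch2_commute) (rule refl)
    also have "t * (10 * t + e) = refl_exponent (int c1) (int c2) t"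
      by (simp add: refl_exponent_def c2 e power2_eq_square algebra_simps)
    finally show ?thesis
      by (simp add: refl_term1_def c2)
  qed
  have t2: "?P * g (2 * t + 1) = - refl_term2 (int c1) (int c2) (int n) (int n) t" for t
  proof -
    have "?P * g (2 * t + 1) = - (fps_X ^ nat ((2 * t + 1) * (5 * t + int c1 + 1)) *
        (?P * qbinom (2 * int n) (int n - (5 * t + int c1 + 1))))"
      unfolding odd by (simp only: ac_simps mult_minus_right)
    also have "(2 * t + 1) * (5 * t + int c1 + 1) =
        refl_exponent (int c1) (int c2) t + 2 * (int c1 + int c2 + 2) * t + int c1 + 1"
      by (simp add: refl_exponent_def c2 power2_eq_square algebra_simps)
    finally show ?thesis
      unfolding qbinom_div_qpoch by (simp add: refl_term2_def c2)
  qed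
  have "infsum g UNIV = infsum g {-2 * N..2 * N + 1}"
    by (rule infsum_cong_neutral) (auto intro: zero)
  also have "\<dots> = (\<Sum>t\<in>{-N..N}. g (2 * t) + g (2 * t + 1))"
    by (simp only: infsum_finite [OF finite_atLeastAtMost_int] sum_int_even_odd)
  finally have "?P * infsum g UNIV = refl_sum (int c1) (int c2) N (int n) (int n)"
    by (simp only: refl_sum_def sum_distrib_left distrib_left t1 t2 diff_conv_add_uminus)
  moreover have "CP (c1, c2) n = refl_sum (int c1) (int c2) N (int n) (int n)"
    unfolding CP_eq_cp_box_gf by (rule cp_box_gf_eq_refl_sum) (auto simp: N_def)
  ultimately show ?thesis
    unfolding g_def by simp
qed

theorem theorem1p1:
  fixes n :: nat
  shows "CP (2, 1) n = 1 / qpoch fps_X fps_X (2 * n) *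
           (\<Sum>\<^sub>\<infinity>r::int\<in>UNIV. fps_const ((-1) powi r) * fps_X ^ nat (r * (5 * r + 1) div 2) *
              qbinom (2 * int n)
                \<lfloor>of_nat n - 5 * of_int r / 2 + ((-1) powi r - 1) / 4 :: rat\<rfloor>) \<and>
         CP (3, 0) n = 1 / qpoch fps_X fps_X (2 * n) *
           (\<Sum>\<^sub>\<infinity>r::int\<in>UNIV. fps_const ((-1) powi r) * fps_X ^ nat (r * (5 * r + 3) div 2) *
              qbinom (2 * int n)
                \<lfloor>of_nat n - 5 * of_int r / 2 + 3 * (((-1) powi r - 1) / 4) :: rat\<rfloor>)"
  using CP_level_3 [of 2 1 1 n] CP_level_3 [of 3 0 3 n] by simp

end
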